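(* There is a universal constant $c>0$ such that for all integers $d\ge1$, $L\ge 2$ and $1\le k\le \tfrac12L^d$, the mixing time $\tau_{\mathrm{mix}}$ of the exclusion process on $G=\mathbf{Z}^d/L\mathbf{Z}^d$ with $k$ black balls satisfies $$\tau_{\mathrm{mix}}\ge c\,L^2\log k .$$
   Context: Exclusion process on a finite connected graph $G=(V,E)$ with $k\le |V|/2$ black balls: a configuration places one ball at each vertex, $k$ of the balls being black and the remaining $|V|-k$ white, with balls of the same color indistinguishable. It is the continuous-time Markov process in which, independently for each edge $e$ at rate 1, the balls at the two endpoints of $e$ are switched. Let $K^t$ be its transition kernel at time $t$, $\mathcal{C}$ the set of configurations (with $k$ black balls), and $\mathcal{U}$ the uniform distribution on $\mathcal{C}$. For probability distributions, $\|\mu-\nu\|=\max_{Q\subset\mathcal{C}}(\mu(Q)-\nu(Q))$ is total variation distance. The mixing time is $\tau_{\mathrm{mix}}=\inf\{t:\|K^t(x,\cdot)-\mathcal{U}\|\le \tfrac14\text{ for all }x\in\mathcal{C}\}$. $\mathbf{Z}^d/L\mathbf{Z}^d$ denotes the $d$-dimensional discrete torus with nearest-neighbor edges and $L^d$ vertices (for $L=2$ it is the hypercube $\{0,1\}^d$ with simple edges). *)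

theory Defs
  imports Complex_Main "HOL-Library.FuncSet" "HOL-Library.Extended_Real"
    "HOL-Combinatorics.Transposition"
begin

text \<open>
  A graph is given by a vertex set and a set of edges, each edge being the set of its endpoints.
  Since balls of the same colour are indistinguishable, a configuration is identified with
  the set of vertices carrying a black ball.
\<close>

definition configs :: "'v set \<Rightarrow> nat \<Rightarrow> 'v set set" where
  "configs V k = {\<eta>. \<eta> \<subseteq> V \<and> card \<eta> = k}"

text \<open>
  The rate from \<open>\<eta>\<close> to \<open>\<zeta>\<close> is the number of edges (each ringing at rate 1) whose switch turns
  \<open>\<eta>\<close> into \<open>\<zeta>\<close>.  Only values at \<open>\<eta> \<noteq> \<zeta>\<close> matter: switching two balls of the same colour
  does not change the configuration.
\<close>

definition jump_rate :: "'v set set \<Rightarrow> 'v set \<Rightarrow> 'v set \<Rightarrow> real" where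
  "jump_rate E \<eta> \<zeta> = real (card {e \<in> E. \<exists>u v. e = {u, v} \<and> transpose u v ` \<eta> = \<zeta>})"

definition generator :: "'v set \<Rightarrow> 'v set set \<Rightarrow> nat \<Rightarrow> 'v set \<Rightarrow> 'v set \<Rightarrow> real" where
  "generator V E k \<eta> \<zeta> =
     (if \<eta> = \<zeta> then - (\<Sum>\<xi> \<in> configs V k - {\<eta>}. jump_rate E \<eta> \<xi>) else jump_rate E \<eta> \<zeta>)"

fun mat_pow :: "'s set \<Rightarrow> ('s \<Rightarrow> 's \<Rightarrow> real) \<Rightarrow> nat \<Rightarrow> 's \<Rightarrow> 's \<Rightarrow> real" where
  "mat_pow S M 0 x y = (if x = y then 1 else 0)"
| "mat_pow S M (Suc n) x y = (\<Sum>z\<in>S. M x z * mat_pow S M n z y)"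

text \<open>The transition kernel is the matrix exponential of \<open>t\<close> times the generator.\<close>

definition kernel :: "'v set \<Rightarrow> 'v set set \<Rightarrow> nat \<Rightarrow> real \<Rightarrow> 'v set \<Rightarrow> 'v set \<Rightarrow> real" where
  "kernel V E k t \<eta> \<zeta> = (\<Sum>n. t ^ n / fact n * mat_pow (configs V k) (generator V E k) n \<eta> \<zeta>)"

definition tv_dist :: "'s set \<Rightarrow> ('s \<Rightarrow> real) \<Rightarrow> ('s \<Rightarrow> real) \<Rightarrow> real" where
  "tv_dist S \<mu> \<nu> = Max ((\<lambda>Q. sum \<mu> Q - sum \<nu> Q) ` Pow S)"

definition uniform :: "'s set \<Rightarrow> 's \<Rightarrow> real" where
  "uniform S x = (if x \<in> S then 1 / real (card S) else 0)"

text \<open>Extended reals are used so that the infimum of the empty set is \<open>\<infinity>\<close>.\<close>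

definition mixing_time :: "'v set \<Rightarrow> 'v set set \<Rightarrow> nat \<Rightarrow> ereal" where
  "mixing_time V E k =
     (INF t \<in> {t::real. 0 \<le> t \<and>
        (\<forall>\<eta> \<in> configs V k. tv_dist (configs V k) (kernel V E k t \<eta>) (uniform (configs V k)) \<le> 1 / 4)}.
      ereal t)"

text \<open>
  Vertices of the torus are represented by their coordinates, reduced to \<open>{0..<L}\<close>.
  For \<open>L = 2\<close> the two neighbours in each direction coincide, and edges being sets
  the graph is the simple hypercube.
\<close>

definition torus_verts :: "nat \<Rightarrow> nat \<Rightarrow> (nat \<Rightarrow> nat) set" where
  "torus_verts d L = {..<d} \<rightarrow>\<^sub>E {..<L}"

definition torus_edges :: "nat \<Rightarrow> nat \<Rightarrow> (nat \<Rightarrow> nat) set set" where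
  "torus_edges d L = {{x, x(i := (x i + 1) mod L)} | x i. x \<in> torus_verts d L \<and> i < d}"

end

(* Wilson's method.  The function F(eta) = sum of cos(2 pi x_0 / L) over the black vertices x is an
   eigenfunction of the generator, with eigenvalue -lam where lam is of order 1/L^2, and its
   carre du champ is O(k/L^2).  Hence its variance is O(k), both in equilibrium and at every time t,
   while its mean started from a maximizer of |F| is at least k e^(-lam t) / 4.  By Chebyshev, mixing
   forces k e^(-2 lam t) = O(1).  For small k this says nothing, but comparing expectations of F
   gives e^(-lam t) <= 1/2 as well, and the two bounds combine to 13 lam t >= ln k. *)
theory Submission imports Defs begin

section \<open>Finite symmetric Markov semigroups\<close>

text \<open>The dimension leaves no trace because only edges in direction 0 change F, so its
  eigenvalue and carre du champ are those of a single cycle. The carre du champ grows with k and not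
  with the volume because exclusion only removes terms from that of k independent walkers. Both
  variance bounds come from one pointwise inequality, act F^2 + 2 lam F^2 <= R: averaged over the
  uniform distribution it bounds the equilibrium variance, and integrated along the semigroup it
  gives a Gronwall inequality at time t. That integration needs a nonnegative kernel, which a power
  series in a matrix with negative diagonal does not display. Starting from a maximizer of |F| makes
  the initial value equal to the sup norm, the scale on which total variation controls
  expectations.\<close>

locale finite_rates =
  fixes S :: "'s set" and M :: "'s \<Rightarrow> 's \<Rightarrow> real"
  assumes finite_S: "finite S"
    and offdiag_nonneg: "\<And>x y. x \<in> S \<Longrightarrow> y \<in> S \<Longrightarrow> x \<noteq> y \<Longrightarrow> 0 \<le> M x y"
    and row_sum: "\<And>x. x \<in> S \<Longrightarrow> (\<Sum>y\<in>S. M x y) = 0"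
    and sym: "\<And>x y. x \<in> S \<Longrightarrow> y \<in> S \<Longrightarrow> M x y = M y x"
begin

definition act :: "('s \<Rightarrow> real) \<Rightarrow> 's \<Rightarrow> real" where
  "act f x = (\<Sum>z\<in>S. M x z * f z)"

definition K :: "real \<Rightarrow> 's \<Rightarrow> 's \<Rightarrow> real" where
  "K t x y = (\<Sum>n. t ^ n / fact n * mat_pow S M n x y)"

lemma act_cong: "(\<And>z. z \<in> S \<Longrightarrow> f z = g z) \<Longrightarrow> act f x = act g x"
  unfolding act_def by (rule sum.cong) auto

section \<open>The matrix exponential as an operator on functions\<close>

lemma mat_pow_apply:
  assumes "x \<in> S"
  shows "(\<Sum>y\<in>S. mat_pow S M n x y * f y) = (act ^^ n) f x"
  using assms
proof (induction n arbitrary: x)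
  case 0
  have "(\<Sum>y\<in>S. mat_pow S M 0 x y * f y) = (\<Sum>y\<in>S. if x = y then f y else 0)"
    by (rule sum.cong) auto
  with 0 finite_S show ?case by simp
next
  case (Suc n)
  have "(\<Sum>y\<in>S. mat_pow S M (Suc n) x y * f y)
      = (\<Sum>y\<in>S. \<Sum>z\<in>S. M x z * (mat_pow S M n z y * f y))"
    by (simp add: sum_distrib_right mult.assoc)
  also have "\<dots> = (\<Sum>z\<in>S. M x z * (\<Sum>y\<in>S. mat_pow S M n z y * f y))"
    by (subst sum.swap) (simp add: sum_distrib_left)
  also have "\<dots> = act ((act ^^ n) f) x"
    unfolding act_def by (rule sum.cong) (use Suc.IH in \<open>auto simp: act_def\<close>)
  finally show ?case by simp
qed

text \<open>The sum of all absolute entries dominates every row sum. The bound is crude and serves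
  only for convergence of the exponential series.\<close>

lemma mat_pow_bound:
  assumes "x \<in> S"
  shows "\<bar>mat_pow S M n x y\<bar> \<le> (\<Sum>a\<in>S. \<Sum>b\<in>S. \<bar>M a b\<bar>) ^ n"
  using assms
proof (induction n arbitrary: x)
  case 0
  then show ?case by simp
next
  case (Suc n)
  define B where "B = (\<Sum>a\<in>S. \<Sum>b\<in>S. \<bar>M a b\<bar>)"
  have B0: "0 \<le> B" unfolding B_def by (intro sum_nonneg) auto
  have row: "(\<Sum>b\<in>S. \<bar>M x b\<bar>) \<le> B" unfolding B_def
    by (rule member_le_sum[of x S "\<lambda>a. \<Sum>b\<in>S. \<bar>M a b\<bar>"])
      (use Suc.prems finite_S in \<open>auto intro: sum_nonneg\<close>)
  have "\<bar>mat_pow S M (Suc n) x y\<bar> \<le> (\<Sum>z\<in>S. \<bar>M x z\<bar> * \<bar>mat_pow S M n z y\<bar>)"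
    by (simp add: order_trans[OF sum_abs] abs_mult)
  also have "\<dots> \<le> (\<Sum>z\<in>S. \<bar>M x z\<bar> * B ^ n)"
    by (intro sum_mono mult_left_mono) (use Suc.IH in \<open>auto simp: B_def\<close>)
  also have "\<dots> \<le> B * B ^ n"
    unfolding sum_distrib_right[symmetric] by (intro mult_right_mono row zero_le_power B0)
  finally show ?case by (simp add: B_def)
qed

lemma summable_mat_exp:
  assumes "x \<in> S"
  shows "summable (\<lambda>n. \<bar>t ^ n / fact n * mat_pow S M n x y\<bar>)"
proof (rule summable_comparison_test)
  define B where "B = (\<Sum>a\<in>S. \<Sum>b\<in>S. \<bar>M a b\<bar>)"
  show "summable (\<lambda>n. inverse (fact n) * (\<bar>t\<bar> * B) ^ n)"
    by (rule summable_exp)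
  have "norm \<bar>t ^ n / fact n * mat_pow S M n x y\<bar> \<le> inverse (fact n) * (\<bar>t\<bar> * B) ^ n" for n
  proof -
    have "\<bar>t\<bar> ^ n * \<bar>mat_pow S M n x y\<bar> \<le> \<bar>t\<bar> ^ n * B ^ n"
      by (intro mult_left_mono) (use mat_pow_bound[OF assms] in \<open>auto simp: B_def\<close>)
    then show ?thesis
      by (simp add: abs_mult power_abs power_mult_distrib field_simps)
  qed
  then show "\<exists>N. \<forall>n\<ge>N. norm \<bar>t ^ n / fact n * mat_pow S M n x y\<bar>
      \<le> inverse (fact n) * (\<bar>t\<bar> * B) ^ n"
    by blast
qed

lemma K_apply_sums:
  assumes "x \<in> S"
  shows "(\<lambda>n. t ^ n / fact n * (act ^^ n) f x) sums (\<Sum>y\<in>S. K t x y * f y)"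
proof -
  have "(\<lambda>n. \<Sum>y\<in>S. t ^ n / fact n * mat_pow S M n x y * f y) sums (\<Sum>y\<in>S. K t x y * f y)"
    unfolding K_def
    by (intro sums_sum sums_mult2 summable_sums) (rule summable_rabs_cancel[OF summable_mat_exp[OF assms]])
  moreover have "(\<Sum>y\<in>S. t ^ n / fact n * mat_pow S M n x y * f y)
      = t ^ n / fact n * (act ^^ n) f x" for n
    by (simp add: mat_pow_apply[OF assms, symmetric] sum_distrib_left mult.assoc)
  ultimately show ?thesis by simp
qed

text \<open>Absolute convergence is what the Cauchy product in \<open>K_nonneg\<close>
  requires.\<close>

lemma summable_abs_act:
  assumes "x \<in> S"
  shows "summable (\<lambda>n. \<bar>t ^ n / fact n * (act ^^ n) f x\<bar>)"
proof (rule summable_comparison_test)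
  show "summable (\<lambda>n. \<Sum>y\<in>S. \<bar>t ^ n / fact n * mat_pow S M n x y\<bar> * \<bar>f y\<bar>)"
    by (intro summable_sum summable_mult2 summable_mat_exp assms)
  have "norm \<bar>t ^ n / fact n * (act ^^ n) f x\<bar>
      \<le> (\<Sum>y\<in>S. \<bar>t ^ n / fact n * mat_pow S M n x y\<bar> * \<bar>f y\<bar>)" for n
    unfolding mat_pow_apply[OF assms, symmetric] sum_distrib_left
    by (simp add: order_trans[OF sum_abs] abs_mult mult.assoc)
  then show "\<exists>N. \<forall>n\<ge>N. norm \<bar>t ^ n / fact n * (act ^^ n) f x\<bar>
      \<le> (\<Sum>y\<in>S. \<bar>t ^ n / fact n * mat_pow S M n x y\<bar> * \<bar>f y\<bar>)" by blast
qed

lemma K_eigen: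
  assumes "x \<in> S" and eig: "\<And>z. z \<in> S \<Longrightarrow> act f z = a * f z"
  shows "(\<Sum>y\<in>S. K t x y * f y) = exp (a * t) * f x"
proof -
  have it: "(act ^^ n) f z = a ^ n * f z" if "z \<in> S" for n z
    using that
  proof (induction n arbitrary: z)
    case (Suc n)
    have "(act ^^ Suc n) f z = act (\<lambda>z. a ^ n * f z) z"
      by (simp, rule act_cong) (rule Suc.IH)
    also have "\<dots> = a ^ n * act f z"
      by (simp add: act_def sum_distrib_left mult_ac)
    finally show ?case using eig Suc.prems by simp
  qed simp
  have "(\<lambda>n. (a * t) ^ n /\<^sub>R fact n * f x) sums (exp (a * t) * f x)"
    by (intro sums_mult2 exp_converges)
  then have "(\<lambda>n. t ^ n / fact n * (act ^^ n) f x) sums (exp (a * t) * f x)"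
    by (simp add: it[OF assms(1)] power_mult_distrib divide_inverse mult_ac)
  then show ?thesis by (rule sums_unique2[OF K_apply_sums[OF assms(1)]])
qed

lemma K_zero: "x \<in> S \<Longrightarrow> (\<Sum>y\<in>S. K 0 x y * f y) = f x"
proof -
  assume x: "x \<in> S"
  have "(\<lambda>n. 0 ^ n / fact n * (act ^^ n) f x) sums (0 ^ 0 / fact 0 * (act ^^ 0) f x)"
    by (rule sums_finite[of "{0}", simplified]) auto
  then have "(\<lambda>n. 0 ^ n / fact n * (act ^^ n) f x) sums f x" by simp
  then show ?thesis by (rule sums_unique2[OF K_apply_sums[OF x]])
qed

text \<open>Termwise differentiation: \<open>diffs\<close> shifts the coefficients by one, and the
  extra application of \<open>act\<close> falls on \<open>f\<close>. Having it inside the kernel sum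
  lets pointwise bounds on \<open>act f\<close> be integrated.\<close>

lemma K_deriv:
  assumes "x \<in> S"
  shows "((\<lambda>t. \<Sum>y\<in>S. K t x y * f y) has_real_derivative (\<Sum>y\<in>S. K t x y * act f y)) (at t)"
proof -
  define c where "c = (\<lambda>n. (act ^^ n) f x / fact n)"
  have s: "(\<lambda>n. c n * t ^ n) sums (\<Sum>y\<in>S. K t x y * f y)" for t
    using K_apply_sums[OF assms, of t f] by (simp add: c_def mult.commute)
  have "diffs c n * t ^ n = t ^ n / fact n * (act ^^ n) (act f) x" for n
    by (simp add: diffs_def c_def funpow_swap1 field_simps del: of_nat_Suc)
  then have d: "(\<Sum>n. diffs c n * t ^ n) = (\<Sum>y\<in>S. K t x y * act f y)"
    using K_apply_sums[OF assms, of t "act f"] by (simp add: sums_iff)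
  have "((\<lambda>t. \<Sum>n. c n * t ^ n) has_real_derivative (\<Sum>n. diffs c n * t ^ n)) (at t)"
    by (rule termdiffs_strong_converges_everywhere) (use s sums_summable in blast)
  then show ?thesis using s d by (simp add: sums_iff)
qed

text \<open>
  The sum is \<open>1 / n!\<close> times the \<open>n\<close>-th power of \<open>M + c\<close>, whose entries are nonnegative, applied
  to \<open>f\<close>: positivity of \<open>K t\<close> follows from \<open>exp (c t) * exp (t M) = exp (t (M + c))\<close>.
\<close>

lemma K_nonneg_aux:
  assumes c: "\<And>x. x \<in> S \<Longrightarrow> - M x x \<le> c" and f: "\<And>x. x \<in> S \<Longrightarrow> 0 \<le> f x" and "x \<in> S"
  shows "0 \<le> (\<Sum>i\<le>n. (act ^^ i) f x / fact i * (c ^ (n - i) / fact (n - i)))"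
  using \<open>x \<in> S\<close>
proof (induction n arbitrary: x)
  case 0
  then show ?case using f by simp
next
  case (Suc n)
  define D where "D = (\<lambda>n x. \<Sum>i\<le>n. (act ^^ i) f x / fact i * (c ^ (n - i) / fact (n - i)))"
  \<comment> \<open>\<open>D n x\<close> is the coefficient of t^n in exp (c t) * exp (t M) f.
    Writing n + 1 = i + (n + 1 - i) is the product rule on coefficients and gives the recursion (n +
    1) D (n + 1) = (M + c) (D n).\<close>
  have "real (Suc n) * D (Suc n) x
      = (\<Sum>i\<le>Suc n. real i * ((act ^^ i) f x / fact i) * (c ^ (Suc n - i) / fact (Suc n - i)))
      + (\<Sum>i\<le>Suc n. (act ^^ i) f x / fact i
          * (real (Suc n - i) * (c ^ (Suc n - i) / fact (Suc n - i))))"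
    unfolding D_def sum_distrib_left sum.distrib[symmetric]
  proof (rule sum.cong[OF refl])
    fix i assume "i \<in> {..Suc n}"
    then have "real (Suc n) = real i + real (Suc n - i)" by auto
    then show "real (Suc n) * ((act ^^ i) f x / fact i * (c ^ (Suc n - i) / fact (Suc n - i)))
      = real i * ((act ^^ i) f x / fact i) * (c ^ (Suc n - i) / fact (Suc n - i))
        + (act ^^ i) f x / fact i * (real (Suc n - i) * (c ^ (Suc n - i) / fact (Suc n - i)))"
      by (simp only: distrib_right mult_ac)
  qed
  also have "(\<Sum>i\<le>Suc n. real i * ((act ^^ i) f x / fact i) * (c ^ (Suc n - i) / fact (Suc n - i)))
      = (\<Sum>i\<le>n. act ((act ^^ i) f) x / fact i * (c ^ (n - i) / fact (n - i)))"
    by (subst sum.atMost_Suc_shift) (simp del: of_nat_Suc)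
  also have "\<dots> = act (D n) x"
    unfolding D_def act_def sum_distrib_left sum_divide_distrib sum_distrib_right
    by (subst sum.swap) (simp add: mult_ac)
  also have "(\<Sum>i\<le>Suc n. (act ^^ i) f x / fact i
          * (real (Suc n - i) * (c ^ (Suc n - i) / fact (Suc n - i))))
      = (\<Sum>i\<le>n. (act ^^ i) f x / fact i
          * (real (Suc n - i) * (c ^ (Suc n - i) / fact (Suc n - i))))"
    by (simp only: sum.atMost_Suc) simp
  also have "\<dots> = (\<Sum>i\<le>n. c * ((act ^^ i) f x / fact i * (c ^ (n - i) / fact (n - i))))"
    by (rule sum.cong[OF refl]) (simp add: Suc_diff_le atMost_iff of_nat_Suc[symmetric] del: of_nat_Suc of_nat_diff)
  also have "\<dots> = c * D n x"
    unfolding D_def sum_distrib_left ..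
  finally have eq: "real (Suc n) * D (Suc n) x = act (D n) x + c * D n x" .
  have "act (D n) x = M x x * D n x + (\<Sum>z\<in>S - {x}. M x z * D n z)"
    unfolding act_def using Suc.prems finite_S by (simp add: sum.remove)
  moreover have "0 \<le> (\<Sum>z\<in>S - {x}. M x z * D n z)"
    using Suc.IH offdiag_nonneg Suc.prems by (intro sum_nonneg mult_nonneg_nonneg) (auto simp: D_def)
  moreover have "0 \<le> (M x x + c) * D n x"
    using c[OF Suc.prems] Suc.IH[OF Suc.prems] by (intro mult_nonneg_nonneg) (auto simp: D_def)
  ultimately have "0 \<le> real (Suc n) * D (Suc n) x" unfolding eq by (simp add: algebra_simps)
  then show ?case unfolding D_def by (simp add: zero_le_mult_iff del: of_nat_Suc)
qed

text \<open>With \<open>f\<close> the indicator of \<open>y\<close>, the Cauchy product of the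
  series for \<open>K t x y\<close> and exp (c t) has nonnegative terms, and the positive
  exponential factor can be divided out. Any \<open>c\<close> dominating all diagonal rates will
  do.\<close>

lemma K_nonneg:
  assumes x: "x \<in> S" and y: "y \<in> S" and t: "0 \<le> t"
  shows "0 \<le> K t x y"
proof -
  define f where "f = (\<lambda>z. if z = y then 1 else 0 :: real)"
  define c where "c = (\<Sum>x\<in>S. \<bar>M x x\<bar>)"
  have c: "- M x x \<le> c" if "x \<in> S" for x
    using member_le_sum[of x S "\<lambda>x. \<bar>M x x\<bar>"] that finite_S unfolding c_def by fastforce
  define a where "a = (\<lambda>n. t ^ n / fact n * (act ^^ n) f x)"
  define b where "b = (\<lambda>n. (c * t) ^ n /\<^sub>R fact n)"
  have Kf: "(\<Sum>z\<in>S. K t x z * f z) = K t x y"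
    using y finite_S by (simp add: f_def if_distrib cong: if_cong)
  have sa: "a sums K t x y"
    using K_apply_sums[OF x, of t f] by (simp add: a_def Kf)
  have sb: "b sums exp (c * t)"
    unfolding b_def by (rule exp_converges)
  have "(\<lambda>n. \<Sum>i\<le>n. a i * b (n - i)) sums ((\<Sum>n. a n) * (\<Sum>n. b n))"
    by (rule Cauchy_product_sums)
      (use summable_abs_act[OF x] summable_norm_exp[of "c * t"] in \<open>auto simp: a_def b_def\<close>)
  then have cp: "(\<lambda>n. \<Sum>i\<le>n. a i * b (n - i)) sums (K t x y * exp (c * t))"
    using sa sb by (simp add: sums_iff)
  have "0 \<le> (\<Sum>i\<le>n. a i * b (n - i))" for n
  proof -
    have "(\<Sum>i\<le>n. a i * b (n - i))
        = t ^ n * (\<Sum>i\<le>n. (act ^^ i) f x / fact i * (c ^ (n - i) / fact (n - i)))"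
      unfolding sum_distrib_left
    proof (rule sum.cong[OF refl])
      fix i assume "i \<in> {..n}"
      then have "t ^ n = t ^ i * t ^ (n - i)" by (simp flip: power_add)
      then show "a i * b (n - i) = t ^ n * ((act ^^ i) f x / fact i * (c ^ (n - i) / fact (n - i)))"
        by (simp add: a_def b_def power_mult_distrib field_simps)
    qed
    also have "\<dots> \<ge> 0"
      using t c by (intro mult_nonneg_nonneg zero_le_power K_nonneg_aux x) (auto simp: f_def)
    finally show ?thesis .
  qed
  then have "0 \<le> K t x y * exp (c * t)"
    by (rule sums_le[OF _ sums_zero cp])
  then show ?thesis by (simp add: zero_le_mult_iff)
qed

section \<open>Conservation of mass, stationarity and second moments\<close>

lemma K_total:
  assumes "x \<in> S"
  shows "(\<Sum>y\<in>S. K t x y) = 1"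
proof -
  have "act (\<lambda>_. 1) z = 0 * 1" if "z \<in> S" for z
    by (simp add: act_def row_sum that)
  from K_eigen[OF assms, of "\<lambda>_. 1" 0, OF this] show ?thesis by simp
qed

text \<open>This is stationarity of the uniform distribution: by symmetry the column sums are row
  sums, hence zero.\<close>

lemma sum_act: "(\<Sum>x\<in>S. act f x) = 0"
proof -
  have "(\<Sum>x\<in>S. act f x) = (\<Sum>z\<in>S. (\<Sum>x\<in>S. M z x) * f z)"
    unfolding act_def sum_distrib_right by (subst sum.swap) (intro sum.cong refl arg_cong2[of _ _ _ _ "(*)"] sym)
  then show ?thesis by (simp add: row_sum)
qed

text \<open>Gronwall: the second moment \<open>g\<close> satisfies g' + 2 lam g <= R, so
  \<open>h\<close>, built with the integrating factor exp (2 lam t), is nonincreasing. For an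
  eigenfunction the left side of \<open>gam\<close> is the carre du champ, and the conclusion says
  that the variance is at most R / (2 lam).\<close>

lemma K_second_moment:
  assumes x: "x \<in> S" and lam: "0 < lam" and t: "0 \<le> t"
    and gam: "\<And>z. z \<in> S \<Longrightarrow> act (\<lambda>y. (F y)\<^sup>2) z + 2 * lam * (F z)\<^sup>2 \<le> R"
    and R: "0 \<le> R"
  shows "(\<Sum>y\<in>S. K t x y * (F y)\<^sup>2) \<le> (exp (- lam * t) * F x)\<^sup>2 + R / (2 * lam)"
proof -
  define g where "g = (\<lambda>t. \<Sum>y\<in>S. K t x y * (F y)\<^sup>2)"
  define g' where "g' = (\<lambda>t. \<Sum>y\<in>S. K t x y * act (\<lambda>y. (F y)\<^sup>2) y)"
  define h where "h = (\<lambda>t. exp (2 * lam * t) * (g t - R / (2 * lam)))"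
  have "\<exists>y. (h has_real_derivative y) (at s) \<and> y \<le> 0" if "0 \<le> s" "s \<le> t" for s
  proof (intro exI conjI)
    have [derivative_intros]: "(g has_real_derivative g' s) (at s)"
      unfolding g_def g'_def by (rule K_deriv[OF x])
    show "(h has_real_derivative exp (2 * lam * s) * (2 * lam * g s + g' s - R)) (at s)"
      unfolding h_def using lam by (auto intro!: derivative_eq_intros simp: field_simps)
    have "g' s + 2 * lam * g s = (\<Sum>y\<in>S. K s x y * (act (\<lambda>y. (F y)\<^sup>2) y + 2 * lam * (F y)\<^sup>2))"
      unfolding g_def g'_def by (simp add: algebra_simps sum.distrib sum_distrib_left)
    also have "\<dots> \<le> (\<Sum>y\<in>S. K s x y * R)"
      using gam K_nonneg[OF x _ that(1)] by (intro sum_mono mult_left_mono)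
    also have "\<dots> = R" using K_total[OF x] by (simp flip: sum_distrib_right)
    finally show "exp (2 * lam * s) * (2 * lam * g s + g' s - R) \<le> 0"
      by (simp add: mult_le_0_iff)
  qed
  then have "h t \<le> h 0"
    using t by (intro DERIV_nonpos_imp_nonincreasing[of 0 t h])
  also have "h 0 \<le> (F x)\<^sup>2"
    using lam R K_zero[OF x, of "\<lambda>y. (F y)\<^sup>2"] by (simp add: h_def g_def)
  finally have "g t - R / (2 * lam) \<le> exp (- (2 * lam * t)) * (F x)\<^sup>2"
    by (simp add: h_def exp_minus field_simps)
  moreover have "exp (- (2 * lam * t)) = (exp (- lam * t))\<^sup>2"
    by (simp flip: exp_double)
  ultimately show ?thesis by (simp add: g_def power_mult_distrib)
qed

end

section \<open>Total variation bounds from test functions\<close>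

lemma tv_dist_ge:
  assumes "finite S" "Q \<subseteq> S"
  shows "sum \<mu> Q - sum \<nu> Q \<le> tv_dist S \<mu> \<nu>"
  unfolding tv_dist_def
proof (rule Max_ge)
  show "finite ((\<lambda>Q. sum \<mu> Q - sum \<nu> Q) ` Pow S)" using assms by simp
  show "sum \<mu> Q - sum \<nu> Q \<in> (\<lambda>Q. sum \<mu> Q - sum \<nu> Q) ` Pow S"
    by (rule image_eqI[of _ _ Q]) (use assms in auto)
qed

text \<open>Equal masses allow \<open>F\<close> to be shifted by \<open>B\<close> into the range
  from 0 to 2 B. Dropping the points where \<mu> is below \<nu> then only increases the sum, and the
  rest is an event.\<close>

lemma tv_dist_expectation:
  assumes S: "finite S" and F: "\<And>y. y \<in> S \<Longrightarrow> \<bar>F y\<bar> \<le> B" and "0 \<le> B"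
    and tot: "sum \<mu> S = sum \<nu> S"
  shows "(\<Sum>y\<in>S. \<mu> y * F y) - (\<Sum>y\<in>S. \<nu> y * F y) \<le> 2 * B * tv_dist S \<mu> \<nu>"
proof -
  define Q where "Q = {y \<in> S. \<nu> y \<le> \<mu> y}"
  have "(\<Sum>y\<in>S. \<mu> y * F y) - (\<Sum>y\<in>S. \<nu> y * F y) = (\<Sum>y\<in>S. (\<mu> y - \<nu> y) * (F y + B))"
    using tot by (simp add: algebra_simps sum.distrib sum_subtractf flip: sum_distrib_left)
  also have "\<dots> \<le> (\<Sum>y\<in>S. if \<nu> y \<le> \<mu> y then (\<mu> y - \<nu> y) * (2 * B) else 0)"
  proof (rule sum_mono)
    fix y assume "y \<in> S"
    from F[OF this] have "0 \<le> F y + B" "F y + B \<le> 2 * B" by auto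
    then show "(\<mu> y - \<nu> y) * (F y + B) \<le> (if \<nu> y \<le> \<mu> y then (\<mu> y - \<nu> y) * (2 * B) else 0)"
      by (auto intro: mult_left_mono mult_nonpos_nonneg)
  qed
  also have "\<dots> = 2 * B * (sum \<mu> Q - sum \<nu> Q)"
    unfolding Q_def sum.inter_filter[OF S, symmetric]
    by (simp add: sum_subtractf flip: sum_distrib_right)
  also have "\<dots> \<le> 2 * B * tv_dist S \<mu> \<nu>"
    using \<open>0 \<le> B\<close> S by (intro mult_left_mono tv_dist_ge) (auto simp: Q_def)
  finally show ?thesis .
qed

text \<open>The test event is |F - m| < m / 2. By Chebyshev its complement has \<mu>-mass at most 4
  v / m^2; on the event F > m / 2, so its \<nu>-mass is also at most 4 v / m^2.\<close>

lemma tv_dist_second_moment: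
  assumes S: "finite S" and \<mu>0: "\<And>y. y \<in> S \<Longrightarrow> 0 \<le> \<mu> y" and \<nu>0: "\<And>y. y \<in> S \<Longrightarrow> 0 \<le> \<nu> y"
    and \<mu>1: "sum \<mu> S = 1"
    and m\<mu>: "(\<Sum>y\<in>S. \<mu> y * F y) = m"
    and v\<mu>: "(\<Sum>y\<in>S. \<mu> y * (F y)\<^sup>2) \<le> m\<^sup>2 + v" and v\<nu>: "(\<Sum>y\<in>S. \<nu> y * (F y)\<^sup>2) \<le> v"
    and "0 < m"
  shows "(1 - tv_dist S \<mu> \<nu>) * m\<^sup>2 \<le> 8 * v"
proof -
  define Q where "Q = {y \<in> S. \<bar>F y - m\<bar> < m / 2}"
  have QS: "Q \<subseteq> S" "finite Q" using S by (auto simp: Q_def)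
  have "sum \<mu> (S - Q) * (m\<^sup>2 / 4) \<le> (\<Sum>y\<in>S - Q. \<mu> y * (F y - m)\<^sup>2)"
    unfolding sum_distrib_right
  proof (intro sum_mono mult_left_mono)
    fix y assume "y \<in> S - Q"
    then have "m / 2 \<le> \<bar>F y - m\<bar>" by (auto simp: Q_def)
    then have "(m / 2)\<^sup>2 \<le> \<bar>F y - m\<bar>\<^sup>2" using \<open>0 < m\<close> by (intro power_mono) auto
    then show "m\<^sup>2 / 4 \<le> (F y - m)\<^sup>2" by (simp add: power_divide)
  qed (use \<mu>0 in auto)
  also have "\<dots> \<le> (\<Sum>y\<in>S. \<mu> y * (F y - m)\<^sup>2)"
    using S \<mu>0 by (intro sum_mono2) auto
  also have "\<dots> = (\<Sum>y\<in>S. \<mu> y * (F y)\<^sup>2 - 2 * m * (\<mu> y * F y) + m\<^sup>2 * \<mu> y)"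
    by (simp add: power2_diff algebra_simps)
  also have "\<dots> = (\<Sum>y\<in>S. \<mu> y * (F y)\<^sup>2) - 2 * m * (\<Sum>y\<in>S. \<mu> y * F y) + m\<^sup>2 * sum \<mu> S"
    by (simp only: sum.distrib sum_subtractf sum_distrib_left)
  also have "\<dots> \<le> v" using v\<mu> m\<mu> \<mu>1 by (simp add: power2_eq_square)
  finally have 1: "(1 - sum \<mu> Q) * (m\<^sup>2 / 4) \<le> v"
    using \<mu>1 S QS by (simp add: sum_diff)
  have "sum \<nu> Q * (m\<^sup>2 / 4) \<le> (\<Sum>y\<in>Q. \<nu> y * (F y)\<^sup>2)"
    unfolding sum_distrib_right
  proof (intro sum_mono mult_left_mono)
    fix y assume "y \<in> Q"
    then have "m / 2 \<le> F y" by (auto simp: Q_def abs_if split: if_splits)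
    then have "(m / 2)\<^sup>2 \<le> (F y)\<^sup>2" using \<open>0 < m\<close> by (intro power_mono) auto
    then show "m\<^sup>2 / 4 \<le> (F y)\<^sup>2" by (simp add: power_divide)
  qed (use \<nu>0 QS in auto)
  also have "\<dots> \<le> (\<Sum>y\<in>S. \<nu> y * (F y)\<^sup>2)"
    using S QS \<nu>0 by (intro sum_mono2) auto
  finally have 2: "sum \<nu> Q * (m\<^sup>2 / 4) \<le> v" using v\<nu> by simp
  have "(1 - tv_dist S \<mu> \<nu>) * m\<^sup>2 \<le> (1 - (sum \<mu> Q - sum \<nu> Q)) * m\<^sup>2"
    using tv_dist_ge[OF S QS(1), of \<mu> \<nu>] by (intro mult_right_mono) auto
  also have "\<dots> \<le> 8 * v" using 1 2 by (simp add: algebra_simps)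
  finally show ?thesis .
qed

section \<open>Wilson's lower bound\<close>

context finite_rates
begin

lemma wilson:
  assumes x: "x \<in> S" and lam: "0 < lam" and t: "0 \<le> t" and R: "0 \<le> R"
    and eig: "\<And>z. z \<in> S \<Longrightarrow> act F z = - lam * F z"
    and gam: "\<And>z. z \<in> S \<Longrightarrow> act (\<lambda>y. (F y)\<^sup>2) z + 2 * lam * (F z)\<^sup>2 \<le> R"
    and max: "\<And>z. z \<in> S \<Longrightarrow> \<bar>F z\<bar> \<le> F x" and pos: "0 < F x"
    and mixed: "tv_dist S (K t x) (uniform S) \<le> 1 / 4"
  shows "exp (- lam * t) \<le> 1 / 2"
    and "3 * (exp (- lam * t) * F x)\<^sup>2 \<le> 16 * R / lam"
proof -
  define m where "m = exp (- lam * t) * F x"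
  have cS: "real (card S) > 0" using x finite_S by (auto simp: card_gt_0_iff)
  have U1: "sum (uniform S) S = 1" using cS by (simp add: uniform_def)
  have Uf: "(\<Sum>y\<in>S. uniform S y * f y) = (\<Sum>y\<in>S. f y) / card S" for f
    by (simp add: uniform_def sum_divide_distrib)
  have KF: "(\<Sum>y\<in>S. K t x y * F y) = m"
    unfolding m_def by (rule K_eigen[OF x eig])
  \<comment> \<open>An eigenfunction with nonzero eigenvalue has mean zero in equilibrium.\<close>
  have "0 = (\<Sum>y\<in>S. act F y)" by (simp add: sum_act)
  also have "\<dots> = - lam * (\<Sum>y\<in>S. F y)" by (simp add: eig sum_distrib_left sum_negf)
  finally have UF: "(\<Sum>y\<in>S. uniform S y * F y) = 0" unfolding Uf using lam by simp
  have "m \<le> 2 * F x * tv_dist S (K t x) (uniform S)"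
    using tv_dist_expectation[where F = F and B = "F x" and \<mu> = "K t x" and \<nu> = "uniform S", OF finite_S max] pos KF UF K_total[OF x] U1
    by simp
  also have "\<dots> \<le> 2 * F x * (1 / 4)" using mixed pos by (intro mult_left_mono) auto
  finally show "exp (- lam * t) \<le> 1 / 2" using pos by (simp add: m_def field_simps)
  \<comment> \<open>Summing \<open>gam\<close> over the whole space removes the \<open>act\<close>
    term by stationarity; this bounds the equilibrium variance without computing any hypergeometric
    moments.\<close>
  have "(\<Sum>y\<in>S. act (\<lambda>y. (F y)\<^sup>2) y + 2 * lam * (F y)\<^sup>2) \<le> (\<Sum>y\<in>S. R)"
    using gam by (rule sum_mono)
  then have "2 * lam * (\<Sum>y\<in>S. (F y)\<^sup>2) \<le> card S * R"
    by (simp add: sum.distrib sum_act sum_distrib_left)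
  then have UF2: "(\<Sum>y\<in>S. uniform S y * (F y)\<^sup>2) \<le> R / (2 * lam)"
    unfolding Uf using lam cS by (simp add: field_simps)
  have "(1 - tv_dist S (K t x) (uniform S)) * m\<^sup>2 \<le> 8 * (R / (2 * lam))"
  proof (rule tv_dist_second_moment[OF finite_S _ _ K_total[OF x] KF _ UF2])
    show "(\<Sum>y\<in>S. K t x y * (F y)\<^sup>2) \<le> m\<^sup>2 + R / (2 * lam)"
      unfolding m_def by (rule K_second_moment[OF x lam t gam R])
  qed (use K_nonneg[OF x _ t] pos in \<open>auto simp: m_def uniform_def\<close>)
  moreover have "(3 / 4) * m\<^sup>2 \<le> (1 - tv_dist S (K t x) (uniform S)) * m\<^sup>2"
    using mixed by (intro mult_right_mono) auto
  ultimately have "(3 / 4) * m\<^sup>2 \<le> 8 * (R / (2 * lam))" by linarith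
  then show "3 * (exp (- lam * t) * F x)\<^sup>2 \<le> 16 * R / lam"
    unfolding m_def[symmetric] using lam by (simp add: field_simps)
qed

end

section \<open>The exclusion process on a finite graph\<close>

text \<open>An edge is an unordered pair and does not name its endpoints. The description is unique
  because transposition is symmetric in them; see \<open>switch_pair\<close>.\<close>

definition switch :: "'v set \<Rightarrow> 'v set \<Rightarrow> 'v set" where
  "switch e \<eta> = (THE \<zeta>. \<exists>u v. e = {u, v} \<and> transpose u v ` \<eta> = \<zeta>)"

lemma switch_iff:
  assumes "e = {a, b}"
  shows "(\<exists>u v. e = {u, v} \<and> transpose u v ` \<eta> = \<zeta>) \<longleftrightarrow> transpose a b ` \<eta> = \<zeta>"
  using assms by (auto simp: doubleton_eq_iff transpose_commute)

lemma switch_pair: "switch {u, v} \<eta> = transpose u v ` \<eta>"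
  unfolding switch_def by (rule the_equality) (simp_all add: switch_iff[OF refl])

lemma finite_configs: "finite V \<Longrightarrow> finite (configs V k)"
  by (rule finite_subset[of _ "Pow V"]) (auto simp: configs_def)

locale finite_graph =
  fixes V :: "'v set" and E :: "'v set set"
  assumes finite_V: "finite V"
    and edges: "\<And>e. e \<in> E \<Longrightarrow> \<exists>u v. u \<in> V \<and> v \<in> V \<and> u \<noteq> v \<and> e = {u, v}"
begin

lemma finite_E: "finite E"
  by (rule finite_subset[of _ "Pow V"]) (use finite_V edges in auto)

lemma switch_switch: "e \<in> E \<Longrightarrow> switch e (switch e \<eta>) = \<eta>"
  by (auto dest!: edges simp: switch_pair image_image)

lemma switch_subset: "e \<in> E \<Longrightarrow> \<eta> \<subseteq> V \<Longrightarrow> switch e \<eta> \<subseteq> V"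
  by (auto dest!: edges simp: switch_pair transpose_def)

lemma switch_configs: "e \<in> E \<Longrightarrow> \<eta> \<in> configs V k \<Longrightarrow> switch e \<eta> \<in> configs V k"
proof -
  assume e: "e \<in> E" and \<eta>: "\<eta> \<in> configs V k"
  have "card (switch e \<eta>) = card \<eta>"
    using edges[OF e] by (auto simp: switch_pair intro!: card_image)
  with switch_subset[OF e] \<eta> show "switch e \<eta> \<in> configs V k" by (auto simp: configs_def)
qed

text \<open>Written as a sum of ones, the rate can be regrouped by target configuration with
  \<open>sum.group\<close>.\<close>

lemma jump_rate_switch: "jump_rate E \<eta> \<zeta> = (\<Sum>e\<in>{e \<in> E. switch e \<eta> = \<zeta>}. 1)"
proof -
  have "{e \<in> E. \<exists>u v. e = {u, v} \<and> transpose u v ` \<eta> = \<zeta>} = {e \<in> E. switch e \<eta> = \<zeta>}"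
  proof (rule Collect_cong, rule conj_cong[OF refl])
    fix e assume "e \<in> E"
    then obtain a b where "e = {a, b}" using edges by blast
    then show "(\<exists>u v. e = {u, v} \<and> transpose u v ` \<eta> = \<zeta>) = (switch e \<eta> = \<zeta>)"
      using switch_iff[of e a b \<eta> \<zeta>] by (simp add: switch_pair)
  qed
  then show ?thesis by (simp add: jump_rate_def)
qed

text \<open>The diagonal entry turns each f \<zeta> into the increment f \<zeta> - f \<eta>, which
  vanishes at \<zeta> = \<eta>. Hence the diagonal term may be restored and switches of equal
  colours may be counted freely.\<close>

lemma generator_apply:
  assumes \<eta>: "\<eta> \<in> configs V k"
  shows "(\<Sum>\<zeta>\<in>configs V k. generator V E k \<eta> \<zeta> * f \<zeta>) = (\<Sum>e\<in>E. f (switch e \<eta>) - f \<eta>)"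
proof -
  let ?C = "configs V k"
  have fin: "finite ?C" by (rule finite_configs[OF finite_V])
  have "(\<Sum>\<zeta>\<in>?C. generator V E k \<eta> \<zeta> * f \<zeta>)
      = generator V E k \<eta> \<eta> * f \<eta> + (\<Sum>\<zeta>\<in>?C - {\<eta>}. generator V E k \<eta> \<zeta> * f \<zeta>)"
    using \<eta> fin by (simp add: sum.remove)
  also have "(\<Sum>\<zeta>\<in>?C - {\<eta>}. generator V E k \<eta> \<zeta> * f \<zeta>) = (\<Sum>\<zeta>\<in>?C - {\<eta>}. jump_rate E \<eta> \<zeta> * f \<zeta>)"
    by (rule sum.cong) (auto simp: generator_def)
  also have "generator V E k \<eta> \<eta> * f \<eta> + (\<Sum>\<zeta>\<in>?C - {\<eta>}. jump_rate E \<eta> \<zeta> * f \<zeta>)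
      = (\<Sum>\<zeta>\<in>?C - {\<eta>}. jump_rate E \<eta> \<zeta> * (f \<zeta> - f \<eta>))"
    by (simp add: generator_def right_diff_distrib sum_subtractf sum_distrib_right)
  also have "\<dots> = (\<Sum>\<zeta>\<in>?C. jump_rate E \<eta> \<zeta> * (f \<zeta> - f \<eta>))"
    using \<eta> fin by (simp add: sum.remove[of ?C \<eta>])
  also have "\<dots> = (\<Sum>\<zeta>\<in>?C. \<Sum>e\<in>{e \<in> E. switch e \<eta> = \<zeta>}. f (switch e \<eta>) - f \<eta>)"
    unfolding jump_rate_switch sum_distrib_right by (intro sum.cong refl) auto
  also have "\<dots> = (\<Sum>e\<in>E. f (switch e \<eta>) - f \<eta>)"
    by (rule sum.group[OF finite_E fin]) (use switch_configs[OF _ \<eta>] in auto)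
  finally show ?thesis .
qed

lemma finite_rates_generator: "finite_rates (configs V k) (generator V E k)"
proof
  show "finite (configs V k)" by (rule finite_configs[OF finite_V])
  show "(\<Sum>\<zeta>\<in>configs V k. generator V E k \<eta> \<zeta>) = 0" if "\<eta> \<in> configs V k" for \<eta>
    using generator_apply[OF that, of "\<lambda>_. 1"] by simp
  show "0 \<le> generator V E k \<eta> \<zeta>" if "\<eta> \<noteq> \<zeta>" for \<eta> \<zeta>
    using that by (simp add: generator_def jump_rate_def)
  have "jump_rate E \<eta> \<zeta> = jump_rate E \<zeta> \<eta>" for \<eta> \<zeta>
  proof -
    have "{e \<in> E. switch e \<eta> = \<zeta>} = {e \<in> E. switch e \<zeta> = \<eta>}"
      using switch_switch by auto
    then show ?thesis by (simp add: jump_rate_switch)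
  qed
  then show "generator V E k \<eta> \<zeta> = generator V E k \<zeta> \<eta>" for \<eta> \<zeta>
    by (simp add: generator_def)
qed

text \<open>The right sides are what independent walkers on \<eta> would contribute. If both
  endpoints are black, the two increments cancel in the first formula; their squares do not, but the
  left side is 0, so exclusion only decreases the second.\<close>

lemma switch_sum:
  fixes \<phi> :: "'v \<Rightarrow> real"
  assumes e: "e \<in> E" and \<eta>: "finite \<eta>"
  shows "sum \<phi> (switch e \<eta>) - sum \<phi> \<eta> = (\<Sum>x\<in>\<eta> \<inter> e. sum \<phi> e - 2 * \<phi> x)"
    and "(sum \<phi> (switch e \<eta>) - sum \<phi> \<eta>)\<^sup>2 \<le> (\<Sum>x\<in>\<eta> \<inter> e. (sum \<phi> e - 2 * \<phi> x)\<^sup>2)"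
proof -
  obtain u v where uv: "u \<noteq> v" "e = {u, v}" using edges[OF e] by blast
  have one: "sum \<phi> (transpose a b ` \<eta>) - sum \<phi> \<eta> = \<phi> b - \<phi> a"
    if "a \<in> \<eta>" "b \<notin> \<eta>" for a b
  proof -
    have "transpose a b ` \<eta> = insert b (\<eta> - {a})"
      using that by (auto simp: in_transpose_image_iff transpose_def split: if_splits)
    then show ?thesis using that \<eta> by (simp add: sum_diff1)
  qed
  consider "u \<in> \<eta>" "v \<in> \<eta>" | "u \<notin> \<eta>" "v \<notin> \<eta>" | "u \<in> \<eta>" "v \<notin> \<eta>" | "u \<notin> \<eta>" "v \<in> \<eta>"
    by blast
  then have "sum \<phi> (switch e \<eta>) - sum \<phi> \<eta> = (\<Sum>x\<in>\<eta> \<inter> e. sum \<phi> e - 2 * \<phi> x)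
    \<and> (sum \<phi> (switch e \<eta>) - sum \<phi> \<eta>)\<^sup>2 \<le> (\<Sum>x\<in>\<eta> \<inter> e. (sum \<phi> e - 2 * \<phi> x)\<^sup>2)"
  proof cases
    case 1
    then show ?thesis using uv by (simp add: switch_pair)
  next
    case 2
    then show ?thesis using uv by (simp add: switch_pair)
  next
    case 3
    then show ?thesis using uv one[of u v] by (simp add: switch_pair)
  next
    case 4
    then show ?thesis using uv one[of v u] by (simp add: switch_pair transpose_commute)
  qed
  then show "sum \<phi> (switch e \<eta>) - sum \<phi> \<eta> = (\<Sum>x\<in>\<eta> \<inter> e. sum \<phi> e - 2 * \<phi> x)"
    and "(sum \<phi> (switch e \<eta>) - sum \<phi> \<eta>)\<^sup>2 \<le> (\<Sum>x\<in>\<eta> \<inter> e. (sum \<phi> e - 2 * \<phi> x)\<^sup>2)"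
    by blast+
qed

lemma sum_edges_swap:
  fixes g :: "'v set \<Rightarrow> 'v \<Rightarrow> real"
  assumes "finite \<eta>"
  shows "(\<Sum>e\<in>E. \<Sum>x\<in>\<eta> \<inter> e. g e x) = (\<Sum>x\<in>\<eta>. \<Sum>e\<in>{e \<in> E. x \<in> e}. g e x)"
  using sum.swap_restrict[OF finite_E assms, of g "\<lambda>e x. x \<in> e"]
  by (simp add: Int_def)

text \<open>
  For an edge \<open>e = {x, y}\<close> the quantity \<open>sum \<phi> e - 2 * \<phi> x\<close> is \<open>\<phi> y - \<phi> x\<close>, so \<open>eig\<close> says that
  \<open>\<phi>\<close> is an eigenfunction of the graph Laplacian.  At first order the interaction between the
  particles cancels, and \<open>\<eta> \<mapsto> sum \<phi> \<eta>\<close> is an eigenfunction of the exclusion generator.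
\<close>

lemma exclusion_mixing:
  fixes \<phi> :: "'v \<Rightarrow> real"
  assumes eig: "\<And>x. x \<in> V \<Longrightarrow> (\<Sum>e\<in>{e \<in> E. x \<in> e}. sum \<phi> e - 2 * \<phi> x) = - lam * \<phi> x"
    and grad: "\<And>x. x \<in> V \<Longrightarrow> (\<Sum>e\<in>{e \<in> E. x \<in> e}. (sum \<phi> e - 2 * \<phi> x)\<^sup>2) \<le> r"
    and lam: "0 < lam" and r: "0 \<le> r" and a: "0 < a"
    and \<eta>0: "\<eta>\<^sub>0 \<in> configs V k" "a \<le> sum \<phi> \<eta>\<^sub>0"
    and t: "0 \<le> t"
    and mixed: "\<And>\<eta>. \<eta> \<in> configs V k \<Longrightarrow>
      tv_dist (configs V k) (kernel V E k t \<eta>) (uniform (configs V k)) \<le> 1 / 4"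
  shows "exp (- lam * t) \<le> 1 / 2"
    and "3 * (exp (- lam * t) * a)\<^sup>2 \<le> 16 * (k * r) / lam"
proof -
  let ?C = "configs V k"
  interpret finite_rates ?C "generator V E k" by (rule finite_rates_generator)
  have K: "K t \<eta> = kernel V E k t \<eta>" for \<eta>
    by (rule ext) (simp add: K_def kernel_def)
  have fin: "finite \<eta>" if "\<eta> \<in> ?C" for \<eta>
    using that finite_V by (auto simp: configs_def intro: finite_subset)
  define s where "s = (\<lambda>b::bool. if b then 1 else - 1 :: real)"
  have "finite ?C" by (rule finite_S)
  then obtain \<eta> where \<eta>: "\<eta> \<in> ?C" and max0: "\<And>\<zeta>. \<zeta> \<in> ?C \<Longrightarrow> \<bar>sum \<phi> \<zeta>\<bar> \<le> \<bar>sum \<phi> \<eta>\<bar>"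
    using \<eta>0(1) ex_is_arg_min_if_finite[of ?C "\<lambda>\<zeta>. - \<bar>sum \<phi> \<zeta>\<bar>"]
    by (auto simp: is_arg_min_linorder)
  \<comment> \<open>The extremal sum may be negative. The sign makes \<open>F\<close> positive at
    \<eta>, as \<open>wilson\<close> demands, and affects neither the eigenvalue nor the
    squares.\<close>
  define \<sigma> where "\<sigma> = sgn (sum \<phi> \<eta>)"
  define F where "F = (\<lambda>\<zeta>. \<sigma> * sum \<phi> \<zeta>)"
  have a_le: "a \<le> \<bar>sum \<phi> \<eta>\<bar>" using max0[OF \<eta>0(1)] \<eta>0(2) by linarith
  then have \<sigma>: "\<sigma>\<^sup>2 = 1" "\<bar>\<sigma>\<bar> = 1" using a by (auto simp: \<sigma>_def sgn_if)
  have F\<eta>: "F \<eta> = \<bar>sum \<phi> \<eta>\<bar>" by (simp add: F_def \<sigma>_def abs_sgn mult.commute)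
  have max: "\<bar>F \<zeta>\<bar> \<le> F \<eta>" if "\<zeta> \<in> ?C" for \<zeta>
    using max0[OF that] by (simp add: F\<eta>) (simp add: F_def abs_mult \<sigma>)
  have act_apply: "act f \<zeta> = (\<Sum>e\<in>E. f (switch e \<zeta>) - f \<zeta>)" if "\<zeta> \<in> ?C" for f \<zeta>
    unfolding act_def by (rule generator_apply[OF that])
  have eigF: "act F \<zeta> = - lam * F \<zeta>" if \<zeta>: "\<zeta> \<in> ?C" for \<zeta>
  proof -
    have "act F \<zeta> = \<sigma> * (\<Sum>e\<in>E. sum \<phi> (switch e \<zeta>) - sum \<phi> \<zeta>)"
      unfolding act_apply[OF \<zeta>] F_def right_diff_distrib[symmetric] sum_distrib_left[symmetric] ..
    also have "(\<Sum>e\<in>E. sum \<phi> (switch e \<zeta>) - sum \<phi> \<zeta>) = (\<Sum>e\<in>E. \<Sum>x\<in>\<zeta> \<inter> e. sum \<phi> e - 2 * \<phi> x)"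
      by (intro sum.cong refl switch_sum(1) fin[OF \<zeta>])
    also have "\<dots> = (\<Sum>x\<in>\<zeta>. - lam * \<phi> x)"
      unfolding sum_edges_swap[OF fin[OF \<zeta>]]
      by (intro sum.cong refl eig) (use \<zeta> in \<open>auto simp: configs_def\<close>)
    finally show ?thesis by (simp add: F_def sum_negf sum_distrib_left mult_ac)
  qed
  have gam: "act (\<lambda>\<zeta>. (F \<zeta>)\<^sup>2) \<zeta> + 2 * lam * (F \<zeta>)\<^sup>2 \<le> k * r" if \<zeta>: "\<zeta> \<in> ?C" for \<zeta>
  proof -
    \<comment> \<open>From b^2 - a^2 = (b - a)^2 + 2 a (b - a): the linear part is the drift, which
      the eigenvalue equation turns into -2 lam F^2, and the squares remain.\<close>
    have "act (\<lambda>\<zeta>. (F \<zeta>)\<^sup>2) \<zeta> = (\<Sum>e\<in>E. (F (switch e \<zeta>) - F \<zeta>)\<^sup>2 + 2 * F \<zeta> * (F (switch e \<zeta>) - F \<zeta>))"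
      unfolding act_apply[OF \<zeta>]
      by (rule sum.cong[OF refl]) (simp add: power2_eq_square algebra_simps)
    also have "\<dots> = (\<Sum>e\<in>E. (F (switch e \<zeta>) - F \<zeta>)\<^sup>2) + 2 * F \<zeta> * act F \<zeta>"
      unfolding act_apply[OF \<zeta>] by (simp only: sum.distrib sum_distrib_left)
    also have "\<dots> = (\<Sum>e\<in>E. (sum \<phi> (switch e \<zeta>) - sum \<phi> \<zeta>)\<^sup>2) - 2 * lam * (F \<zeta>)\<^sup>2"
      unfolding eigF[OF \<zeta>] unfolding F_def right_diff_distrib[symmetric] power_mult_distrib \<sigma>
      using \<sigma>(1) by (simp add: power2_eq_square)
    finally have "act (\<lambda>\<zeta>. (F \<zeta>)\<^sup>2) \<zeta> + 2 * lam * (F \<zeta>)\<^sup>2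
        = (\<Sum>e\<in>E. (sum \<phi> (switch e \<zeta>) - sum \<phi> \<zeta>)\<^sup>2)" by simp
    also have "\<dots> \<le> (\<Sum>e\<in>E. \<Sum>x\<in>\<zeta> \<inter> e. (sum \<phi> e - 2 * \<phi> x)\<^sup>2)"
      by (intro sum_mono switch_sum(2) fin[OF \<zeta>])
    also have "\<dots> \<le> (\<Sum>x\<in>\<zeta>. r)"
      unfolding sum_edges_swap[OF fin[OF \<zeta>]]
      by (intro sum_mono grad) (use \<zeta> in \<open>auto simp: configs_def\<close>)
    also have "\<dots> = k * r" using \<zeta> by (simp add: configs_def)
    finally show ?thesis .
  qed
  have kr: "0 \<le> k * r" using r by simp
  have pos: "0 < F \<eta>" using a a_le by (simp add: F\<eta>)
  note W = wilson[OF \<eta> lam t kr eigF gam max pos mixed[OF \<eta>, folded K]]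
  from W(1) show "exp (- lam * t) \<le> 1 / 2" .
  have "(exp (- lam * t) * a)\<^sup>2 \<le> (exp (- lam * t) * F \<eta>)\<^sup>2"
    using a a_le by (intro power_mono mult_left_mono) (auto simp: F\<eta>)
  with W(2) show "3 * (exp (- lam * t) * a)\<^sup>2 \<le> 16 * (k * r) / lam" by linarith
qed

end

section \<open>A starting configuration on which the eigenfunction is large\<close>

text \<open>Discarding an element where \<phi> is minimal never lowers the average. The inequality
  is multiplied out to avoid division by zero cardinalities.\<close>

lemma subset_sum_ge_average:
  fixes \<phi> :: "'a \<Rightarrow> real"
  assumes "finite A" "m \<le> card A"
  shows "\<exists>T\<subseteq>A. card T = m \<and> m * sum \<phi> A \<le> card A * sum \<phi> T"
  using assms
proof (induction "card A" arbitrary: A)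
  case 0
  then show ?case by auto
next
  case (Suc n)
  show ?case
  proof (cases "m = Suc n")
    case True
    then show ?thesis using Suc by (intro exI[of _ A]) auto
  next
    case False
    from Suc.hyps(2) have "A \<noteq> {}" by auto
    then obtain a where a: "a \<in> A" and amin: "\<And>x. x \<in> A \<Longrightarrow> \<phi> a \<le> \<phi> x"
      using ex_is_arg_min_if_finite[OF Suc.prems(1), of \<phi>] by (auto simp: is_arg_min_linorder)
    have cA: "card (A - {a}) = n" using a Suc by simp
    obtain T where T: "T \<subseteq> A - {a}" "card T = m" "m * sum \<phi> (A - {a}) \<le> n * sum \<phi> T"
      using Suc.hyps(1)[of "A - {a}"] cA Suc False by auto
    show ?thesis
    proof (cases "n = 0")
      case True
      then have "m = 0" using Suc False by simp
      then show ?thesis by (intro exI[of _ "{}"]) auto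
    next
      case n: False
      have "(\<Sum>x\<in>A. \<phi> a) \<le> sum \<phi> A" by (rule sum_mono) (rule amin)
      then have 1: "Suc n * \<phi> a \<le> sum \<phi> A" using Suc.hyps(2) by simp
      have "sum \<phi> A = \<phi> a + sum \<phi> (A - {a})" using a Suc.prems(1) by (rule sum.remove[rotated])
      then have "n * sum \<phi> A \<le> Suc n * sum \<phi> (A - {a})"
        using 1 by (simp only: of_nat_Suc distrib_left distrib_right)
      then have "m * (n * sum \<phi> A) \<le> m * (Suc n * sum \<phi> (A - {a}))" by (intro mult_left_mono) auto
      also have "\<dots> = Suc n * (m * sum \<phi> (A - {a}))" by simp
      also have "\<dots> \<le> Suc n * (n * sum \<phi> T)" by (intro mult_left_mono T) auto
      finally have "n * (m * sum \<phi> A) \<le> n * (Suc n * sum \<phi> T)" by (simp only: mult_ac)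
      then have "m * sum \<phi> A \<le> Suc n * sum \<phi> T" using n by simp
      then show ?thesis using T Suc.hyps(2) by (intro exI[of _ T]) auto
    qed
  qed
qed

text \<open>Since |\<phi>| >= \<phi>^2, the absolute values sum to at least |V| / 2, and zero mean
  puts at least |V| / 4 of this on the nonnegative part P. Either the best k vertices of P suffice,
  or P is filled completely and the least harmful vertices of N are added.\<close>

lemma configs_large_sum:
  fixes \<phi> :: "'a \<Rightarrow> real"
  assumes V: "finite V" and k: "2 * k \<le> card V" and zero: "sum \<phi> V = 0"
    and abs1: "\<And>x. x \<in> V \<Longrightarrow> \<bar>\<phi> x\<bar> \<le> 1" and sq: "card V \<le> 2 * (\<Sum>x\<in>V. (\<phi> x)\<^sup>2)"
  shows "\<exists>\<eta>\<in>configs V k. real k / 4 \<le> sum \<phi> \<eta>"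
proof -
  define P where "P = {x \<in> V. 0 \<le> \<phi> x}"
  define N where "N = {x \<in> V. \<not> 0 \<le> \<phi> x}"
  have PN: "V = P \<union> N" "P \<inter> N = {}" "finite P" "finite N" using V by (auto simp: P_def N_def)
  have split: "sum f V = sum f P + sum f N" for f :: "'a \<Rightarrow> real"
    using PN by (simp add: sum.union_disjoint)
  have cV: "card V = card P + card N" using PN by (simp add: card_Un_disjoint)
  have "(\<Sum>x\<in>V. (\<phi> x)\<^sup>2) \<le> (\<Sum>x\<in>V. \<bar>\<phi> x\<bar>)"
  proof (rule sum_mono)
    fix x assume "x \<in> V"
    then have "\<bar>\<phi> x\<bar> * \<bar>\<phi> x\<bar> \<le> \<bar>\<phi> x\<bar> * 1" using abs1 by (intro mult_left_mono) auto
    then show "(\<phi> x)\<^sup>2 \<le> \<bar>\<phi> x\<bar>" by (simp add: power2_eq_square)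
  qed
  also have "\<dots> = sum \<phi> P - sum \<phi> N"
    unfolding split by (simp add: P_def N_def sum_negf[symmetric])
  finally have S: "card V \<le> 4 * sum \<phi> P" using sq zero split[of \<phi>] by simp
  have PP: "0 \<le> sum \<phi> P" by (rule sum_nonneg) (auto simp: P_def)
  show ?thesis
  proof (cases "k \<le> card P")
    case True
    then obtain T where T: "T \<subseteq> P" "card T = k" "k * sum \<phi> P \<le> card P * sum \<phi> T"
      using subset_sum_ge_average[OF PN(3), of k \<phi>] by blast
    have T0: "0 \<le> sum \<phi> T" by (rule sum_nonneg) (use T in \<open>auto simp: P_def\<close>)
    have "real k / 4 \<le> sum \<phi> T"
    proof (cases "k = 0")
      case False
      have "real k * (card V / 4) \<le> k * sum \<phi> P" using S by (intro mult_left_mono) auto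
      also have "\<dots> \<le> card P * sum \<phi> T" by (rule T)
      also have "\<dots> \<le> card V * sum \<phi> T" using T0 cV by (intro mult_right_mono) auto
      finally have "card V * (real k / 4) \<le> card V * sum \<phi> T" by (simp add: mult_ac)
      then show ?thesis using False k by simp
    qed (simp add: T0)
    then show ?thesis using T by (intro bexI[of _ T]) (auto simp: configs_def P_def)
  next
    case False
    define j where "j = k - card P"
    have j: "k = card P + j" "j \<le> card N" using False k cV by (auto simp: j_def)
    then obtain T where T: "T \<subseteq> N" "card T = j" "j * sum \<phi> N \<le> card N * sum \<phi> T"
      using subset_sum_ge_average[OF PN(4), of j \<phi>] by blast
    have fT: "finite T" "P \<inter> T = {}" using T PN by (auto intro: finite_subset)
    have N: "sum \<phi> N = - sum \<phi> P" using zero split[of \<phi>] by simp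
    \<comment> \<open>This is 2 j <= |N|, which follows from 2 k <= |V|. The added vertices thus
      cost at most half of the sum over P, leaving at least |V| / 8 >= k / 4.\<close>
    have "card N * sum \<phi> P \<le> (2 * real (card N) - 2 * j) * sum \<phi> P"
      using k cV j PP by (intro mult_right_mono) auto
    also have "\<dots> = 2 * (card N * sum \<phi> P) - 2 * (j * sum \<phi> P)"
      by (simp add: algebra_simps)
    also have "\<dots> \<le> 2 * (card N * sum \<phi> P) + 2 * (card N * sum \<phi> T)"
      using T(3) unfolding N by (simp add: mult.commute)
    also have "\<dots> = card N * (2 * (sum \<phi> P + sum \<phi> T))"
      by (simp add: algebra_simps)
    finally have "card N * sum \<phi> P \<le> card N * (2 * (sum \<phi> P + sum \<phi> T))" .
    moreover have "card N > 0" using k cV j False by auto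
    ultimately have "sum \<phi> P \<le> 2 * (sum \<phi> P + sum \<phi> T)" by simp
    then have "real k / 4 \<le> sum \<phi> (P \<union> T)" using S k fT PN by (simp add: sum.union_disjoint)
    moreover have "P \<union> T \<in> configs V k"
      using fT PN T j by (auto simp: configs_def card_Un_disjoint)
    ultimately show ?thesis by blast
  qed
qed

section \<open>The torus\<close>

lemma cos_lipschitz: "\<bar>cos (w::real) - cos z\<bar> \<le> \<bar>w - z\<bar>"
proof -
  have "\<bar>cos w - cos z\<bar> = 2 * (\<bar>sin ((w + z) / 2)\<bar> * \<bar>sin ((z - w) / 2)\<bar>)"
    by (simp add: cos_diff_cos abs_mult)
  also have "\<dots> \<le> 2 * (1 * \<bar>(z - w) / 2\<bar>)"
    by (intro mult_left_mono mult_mono abs_sin_le_one abs_sin_x_le_abs_x) auto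
  finally show ?thesis by simp
qed

text \<open>The slope of sine is at least cos (pi / 3) = 1 / 2 on this range, which contains
  \<theta> / 2 as soon as L >= 3.\<close>

lemma sin_ge_half:
  assumes "0 \<le> y" "y \<le> pi / 3"
  shows "y / 2 \<le> sin y"
proof (cases "y = 0")
  case False
  then have "0 < y" using assms by simp
  then obtain z where z: "0 < z" "z < y" "sin y - sin 0 = (y - 0) * cos z"
    using MVT2[of 0 y sin cos] DERIV_sin by blast
  have "cos (pi / 3) \<le> cos z"
    using z assms by (intro cos_monotone_0_pi_le) auto
  then have "y * (1 / 2) \<le> y * cos z"
    using \<open>0 < y\<close> by (intro mult_left_mono) (auto simp: cos_60)
  then show ?thesis using z by simp
qed simp

locale torus =
  fixes d L :: nat
  assumes d: "1 \<le> d" and L: "2 \<le> L"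
begin

abbreviation "V \<equiv> torus_verts d L"
abbreviation "E \<equiv> torus_edges d L"

section \<open>Coordinate steps and the lowest Fourier mode\<close>

definition up :: "(nat \<Rightarrow> nat) \<Rightarrow> nat \<Rightarrow> nat \<Rightarrow> nat" where
  "up x i = x(i := (x i + 1) mod L)"

text \<open>Adding \<open>L\<close> before subtracting 1 avoids truncated subtraction at coordinate
  0.\<close>

definition down :: "(nat \<Rightarrow> nat) \<Rightarrow> nat \<Rightarrow> nat \<Rightarrow> nat" where
  "down x i = x(i := (x i + L - 1) mod L)"

definition \<theta> :: real where "\<theta> = 2 * pi / L"

definition \<phi> :: "(nat \<Rightarrow> nat) \<Rightarrow> real" where "\<phi> x = cos (\<theta> * x 0)"

text \<open>For L = 2 the two neighbours in a direction coincide and give one edge, so the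
  eigenvalue is half of 2 (1 - cos pi) = 4.\<close>

definition lam :: real where "lam = (if L = 2 then 2 else 2 * (1 - cos \<theta>))"

lemma edges_eq: "E = {{x, up x i} | x i. x \<in> V \<and> i < d}"
  by (simp add: torus_edges_def up_def)

lemma finite_verts: "finite V"
  unfolding torus_verts_def by (intro finite_PiE) auto

lemma card_verts: "card V = L ^ d"
  by (simp add: torus_verts_def card_funcsetE)

lemma vert_less: "x \<in> V \<Longrightarrow> i < d \<Longrightarrow> x i < L"
  by (auto simp: torus_verts_def)

lemma succ_mod: "a < L \<Longrightarrow> (a + 1) mod L = (if a + 1 = L then 0 else a + 1)"
  by auto

lemma pred_mod: "a < L \<Longrightarrow> (a + L - 1) mod L = (if a = 0 then L - 1 else a - 1)"
proof (cases "a = 0")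
  case False
  assume "a < L"
  then have "(a + L - 1) mod L = ((a - 1) + L) mod L" using False by simp
  also have "\<dots> = a - 1" using \<open>a < L\<close> by (simp only: mod_add_self2) simp
  finally show ?thesis using False by simp
qed (use L in simp)

lemma up_verts: "x \<in> V \<Longrightarrow> i < d \<Longrightarrow> up x i \<in> V"
  and down_verts: "x \<in> V \<Longrightarrow> i < d \<Longrightarrow> down x i \<in> V"
  using L by (auto simp: torus_verts_def up_def down_def PiE_iff extensional_def)

lemma up_if: "x \<in> V \<Longrightarrow> i < d \<Longrightarrow> up x i = x(i := if x i + 1 = L then 0 else x i + 1)"
  unfolding up_def by (subst succ_mod) (auto simp: vert_less)

lemma down_if: "x \<in> V \<Longrightarrow> i < d \<Longrightarrow> down x i = x(i := if x i = 0 then L - 1 else x i - 1)"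
  unfolding down_def by (subst pred_mod) (auto simp: vert_less)

lemma down_up: "x \<in> V \<Longrightarrow> i < d \<Longrightarrow> down (up x i) i = x"
  using L by (simp add: down_if up_verts) (auto simp: up_if fun_eq_iff)

lemma up_down: "x \<in> V \<Longrightarrow> i < d \<Longrightarrow> up (down x i) i = x"
  using L vert_less[of x i] by (simp add: up_if down_verts) (auto simp: down_if fun_eq_iff)

lemma up_neq: "x \<in> V \<Longrightarrow> i < d \<Longrightarrow> up x i \<noteq> x"
  using L by (auto simp: up_if fun_eq_iff intro!: exI[of _ i])

lemma up_eq_down_iff:
  assumes "x \<in> V" "i < d"
  shows "up x i = down x i \<longleftrightarrow> L = 2"
proof -
  have "up x i = down x i \<longleftrightarrow> up x i i = down x i i"
    by (auto simp: up_def down_def fun_eq_iff)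
  then show ?thesis using L vert_less[OF assms] assms by (auto simp: up_if down_if)
qed

sublocale finite_graph V E
proof
  show "finite V" by (rule finite_verts)
  show "\<exists>u v. u \<in> V \<and> v \<in> V \<and> u \<noteq> v \<and> e = {u, v}" if "e \<in> E" for e
    using that up_verts up_neq unfolding edges_eq by fastforce
qed

section \<open>Trigonometric sums over the torus\<close>

lemma theta_L: "\<theta> * L = 2 * pi"
  using L by (simp add: \<theta>_def)

text \<open>Reduction modulo L is invisible to the cosine, since m \<theta> L is a multiple of 2 pi.
  The frequency m = 1 serves \<phi>, and m = 2 its square.\<close>

lemma cos_up:
  assumes "x \<in> V"
  shows "cos (real m * \<theta> * (up x 0) 0) = cos (real m * \<theta> * x 0 + real m * \<theta>)"
proof (cases "x 0 + 1 = L")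
  case True
  have "real m * \<theta> * x 0 + real m * \<theta> = real m * (\<theta> * real (x 0 + 1))"
    by (simp add: algebra_simps)
  also have "\<dots> = 2 * real m * pi" unfolding True theta_L by simp
  finally show ?thesis using True by (simp add: up_def)
next
  case False
  then show ?thesis using assms d by (simp add: up_if algebra_simps)
qed

lemma cos_down:
  assumes "x \<in> V"
  shows "cos (real m * \<theta> * (down x 0) 0) = cos (real m * \<theta> * x 0 - real m * \<theta>)"
proof (cases "x 0 = 0")
  case True
  have "real m * \<theta> * real (L - 1) = real m * (\<theta> * L) - real m * \<theta>"
    using L by (simp add: of_nat_diff algebra_simps)
  also have "\<dots> = 2 * real m * pi - real m * \<theta>" unfolding theta_L by simp
  finally show ?thesis using True L by (simp add: down_def cos_diff)
next
  case False
  then show ?thesis using assms d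
    by (simp add: down_if of_nat_diff algebra_simps)
qed

text \<open>Shifting coordinate 0 preserves the sum, while adding the two opposite shifts multiplies
  it by 2 cos (m \<theta>).\<close>

lemma sum_cos_zero:
  assumes "cos (real m * \<theta>) \<noteq> 1"
  shows "(\<Sum>x\<in>V. cos (real m * \<theta> * x 0)) = 0"
proof -
  let ?f = "\<lambda>x. cos (real m * \<theta> * (x 0))"
  have d0: "0 < d" using d by simp
  have 1: "(\<Sum>x\<in>V. ?f (up x 0)) = (\<Sum>x\<in>V. ?f x)"
    by (rule sum.reindex_bij_witness[where i = "\<lambda>x. down x 0" and j = "\<lambda>x. up x 0"])
      (simp_all add: up_verts down_verts up_down down_up d0)
  have 2: "(\<Sum>x\<in>V. ?f (down x 0)) = (\<Sum>x\<in>V. ?f x)"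
    by (rule sum.reindex_bij_witness[where i = "\<lambda>x. up x 0" and j = "\<lambda>x. down x 0"])
      (simp_all add: up_verts down_verts up_down down_up d0)
  have "2 * (\<Sum>x\<in>V. ?f x) = (\<Sum>x\<in>V. ?f (up x 0) + ?f (down x 0))"
    by (simp only: sum.distrib 1 2 mult_2)
  also have "\<dots> = (\<Sum>x\<in>V. 2 * cos (real m * \<theta>) * ?f x)"
    by (intro sum.cong refl) (simp add: cos_up cos_down cos_add cos_diff)
  also have "\<dots> = 2 * cos (real m * \<theta>) * (\<Sum>x\<in>V. ?f x)"
    by (simp only: sum_distrib_left)
  finally show ?thesis using assms by simp
qed

lemma theta_2: "L = 2 \<Longrightarrow> \<theta> = pi"
  unfolding \<theta>_def by simp

lemma theta_pos: "0 < \<theta>"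
  using L by (simp add: \<theta>_def)

lemma theta_le: "\<theta> \<le> 2 * pi / n" if "n \<le> L" "0 < n"
  unfolding \<theta>_def using that by (intro divide_left_mono) auto

lemma sum_phi: "sum \<phi> V = 0"
proof -
  have "0 < sin (\<theta> / 2)"
    using theta_pos theta_le[OF L] pi_gt_zero by (intro sin_gt_zero) auto
  then have "cos \<theta> \<noteq> 1" using cos_double_sin[of "\<theta> / 2"] by simp
  then show ?thesis using sum_cos_zero[of 1] by (simp add: \<phi>_def[abs_def])
qed

text \<open>From 2 cos^2 = 1 + cos of the doubled angle. The doubled mode sums to zero for L >= 3;
  for L = 2 it is constantly 1, which still has the right sign.\<close>

lemma sum_phi_squared: "card V \<le> 2 * (\<Sum>x\<in>V. (\<phi> x)\<^sup>2)"
proof -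
  have "0 \<le> (\<Sum>x\<in>V. cos (real 2 * \<theta> * x 0))"
  proof (cases "L = 2")
    case True
    then have "real 2 * \<theta> = 2 * pi" using theta_2 by simp
    then have "cos (real 2 * \<theta> * real n) = 1" for n
      using cos_2npi[of n] by (simp add: mult_ac)
    then show ?thesis by simp
  next
    case False
    have "0 < sin \<theta>"
      using theta_pos theta_le[of 3] L False pi_gt_zero by (intro sin_gt_zero) auto
    then have "cos (real 2 * \<theta>) \<noteq> 1" using cos_double_sin[of \<theta>] by simp
    then show ?thesis using sum_cos_zero[of 2] by simp
  qed
  also have "(\<Sum>x\<in>V. cos (real 2 * \<theta> * x 0)) = (\<Sum>x\<in>V. 2 * (\<phi> x)\<^sup>2 - 1)"
    using cos_double_cos[of "\<theta> * real n" for n] by (simp add: \<phi>_def mult.assoc)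
  also have "\<dots> = 2 * (\<Sum>x\<in>V. (\<phi> x)\<^sup>2) - card V"
    by (simp add: sum_subtractf sum_distrib_left)
  finally show ?thesis by simp
qed

section \<open>Eigenvalue and gradient of the Fourier mode\<close>

text \<open>Edges in other directions leave \<phi> unchanged and vanish under \<open>h\<close>.
  Keeping \<open>h\<close> general serves both the Laplacian (identity) and the gradient
  (square).\<close>

lemma sum_incident:
  fixes h :: "real \<Rightarrow> real"
  assumes x: "x \<in> V" and h: "h 0 = 0"
  shows "(\<Sum>e\<in>{e \<in> E. x \<in> e}. h (sum \<phi> e - 2 * \<phi> x))
    = (if L = 2 then h (\<phi> (up x 0) - \<phi> x) else h (\<phi> (up x 0) - \<phi> x) + h (\<phi> (down x 0) - \<phi> x))"
proof -
  have d0: "0 < d" using d by simp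
  let ?u = "{x, up x 0}" and ?d = "{down x 0, x}"
  have neq: "up x 0 \<noteq> x" "down x 0 \<noteq> x"
    using up_neq[OF x d0] up_neq[OF down_verts[OF x d0] d0] up_down[OF x d0] by auto
  have "(\<Sum>e\<in>{e \<in> E. x \<in> e}. h (sum \<phi> e - 2 * \<phi> x)) = (\<Sum>e\<in>{?u, ?d}. h (sum \<phi> e - 2 * \<phi> x))"
  proof (rule sum.mono_neutral_right)
    show "finite {e \<in> E. x \<in> e}" using finite_E by simp
    have "?d = {down x 0, up (down x 0) 0}" by (simp add: up_down x d0)
    then have "?d \<in> E" unfolding edges_eq using down_verts[OF x d0] d0 by blast
    moreover have "?u \<in> E" unfolding edges_eq using x d0 by blast
    ultimately show "{?u, ?d} \<subseteq> {e \<in> E. x \<in> e}" by simp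
    show "\<forall>e\<in>{e \<in> E. x \<in> e} - {?u, ?d}. h (sum \<phi> e - 2 * \<phi> x) = 0"
    proof
      fix e assume e: "e \<in> {e \<in> E. x \<in> e} - {?u, ?d}"
      then obtain y i where y: "e = {y, up y i}" "y \<in> V" "i < d" "x \<in> e"
        unfolding edges_eq by blast
      have "i \<noteq> 0"
      proof
        assume "i = 0"
        then have "e = ?u \<or> e = ?d" using y down_up[of y 0] by auto
        with e show False by simp
      qed
      then have "\<phi> (up y i) = \<phi> y" by (simp add: \<phi>_def up_def)
      then have "sum \<phi> e = 2 * \<phi> x" using y up_neq[of y i] by auto
      then show "h (sum \<phi> e - 2 * \<phi> x) = 0" using h by simp
    qed
  qed
  also have "\<dots> = (if L = 2 then h (\<phi> (up x 0) - \<phi> x)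
      else h (\<phi> (up x 0) - \<phi> x) + h (\<phi> (down x 0) - \<phi> x))"
  proof (cases "L = 2")
    case True
    then have "?d = ?u" using up_eq_down_iff[OF x d0] by auto
    then show ?thesis using True neq by simp
  next
    case False
    then have "?u \<noteq> ?d" using up_eq_down_iff[OF x d0] neq by (auto simp: doubleton_eq_iff)
    then show ?thesis using False neq by simp
  qed
  finally show ?thesis .
qed

lemma phi_up: "x \<in> V \<Longrightarrow> \<phi> (up x 0) = cos (\<theta> * x 0 + \<theta>)"
  and phi_down: "x \<in> V \<Longrightarrow> \<phi> (down x 0) = cos (\<theta> * x 0 - \<theta>)"
  using cos_up[of x 1] cos_down[of x 1] by (simp_all add: \<phi>_def)

lemma phi_eigen:
  assumes "x \<in> V"
  shows "(\<Sum>e\<in>{e \<in> E. x \<in> e}. sum \<phi> e - 2 * \<phi> x) = - lam * \<phi> x"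
proof (cases "L = 2")
  case True
  then show ?thesis using sum_incident[OF assms, of "\<lambda>s. s"] phi_up[OF assms]
    unfolding lam_def \<phi>_def theta_2[OF True] by simp
next
  case False
  then show ?thesis
    using sum_incident[OF assms, of "\<lambda>s. s"] phi_up[OF assms] phi_down[OF assms]
    by (simp add: lam_def) (simp add: \<phi>_def cos_add cos_diff algebra_simps)
qed

lemma phi_gradient:
  assumes "x \<in> V"
  shows "(\<Sum>e\<in>{e \<in> E. x \<in> e}. (sum \<phi> e - 2 * \<phi> x)\<^sup>2) \<le> 2 * \<theta>\<^sup>2"
proof -
  have "\<bar>\<phi> (up x 0) - \<phi> x\<bar> \<le> \<theta>" "\<bar>\<phi> (down x 0) - \<phi> x\<bar> \<le> \<theta>"
    unfolding phi_up[OF assms] phi_down[OF assms] unfolding \<phi>_def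
    using cos_lipschitz[of "\<theta> * x 0 + \<theta>" "\<theta> * x 0"] cos_lipschitz[of "\<theta> * x 0 - \<theta>" "\<theta> * x 0"] theta_pos
    by auto
  then have "(\<phi> (up x 0) - \<phi> x)\<^sup>2 \<le> \<theta>\<^sup>2" "(\<phi> (down x 0) - \<phi> x)\<^sup>2 \<le> \<theta>\<^sup>2"
    using theta_pos by (simp_all flip: abs_le_square_iff)
  moreover have "0 \<le> \<theta>\<^sup>2" by simp
  ultimately show ?thesis
    unfolding sum_incident[OF assms, of "\<lambda>s. s\<^sup>2", simplified] by (smt (verit))
qed

text \<open>For L >= 3, lam = 4 (sin (\<theta> / 2))^2 lies between \<theta>^2 / 4 and \<theta>^2.
  The constant 1 / 8 makes room for L = 2, where lam / \<theta>^2 = 2 / pi^2 is below 1 / 4.\<close>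

lemma lam_bounds: "\<theta>\<^sup>2 / 8 \<le> lam" "lam \<le> \<theta>\<^sup>2"
proof -
  have "\<theta>\<^sup>2 / 8 \<le> lam \<and> lam \<le> \<theta>\<^sup>2"
  proof (cases "L = 2")
    case True
    have "pi\<^sup>2 \<le> 4\<^sup>2" "2\<^sup>2 \<le> pi\<^sup>2"
      by (rule power_mono; use pi_less_4 pi_ge_two in simp)+
    then show ?thesis unfolding lam_def theta_2[OF True] using True by simp
  next
    case False
    then have "lam = 4 * (sin (\<theta> / 2))\<^sup>2"
      using cos_double_sin[of "\<theta> / 2"] by (simp add: lam_def)
    moreover have "\<theta> / 2 / 2 \<le> sin (\<theta> / 2)"
      using theta_pos theta_le[of 3] L False by (intro sin_ge_half) auto
    then have "(\<theta> / 2 / 2)\<^sup>2 \<le> (sin (\<theta> / 2))\<^sup>2"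
      using theta_pos by (intro power_mono) auto
    moreover have "\<bar>sin (\<theta> / 2)\<bar>\<^sup>2 \<le> \<bar>\<theta> / 2\<bar>\<^sup>2"
      by (intro power_mono abs_sin_x_le_abs_x) auto
    ultimately show ?thesis by (simp add: power_divide)
  qed
  then show "\<theta>\<^sup>2 / 8 \<le> lam" "lam \<le> \<theta>\<^sup>2" by blast+
qed

lemma mixing_lower_bound:
  assumes k: "1 \<le> k" "real k \<le> 1 / 2 * real L ^ d" and t: "0 \<le> t"
    and mixed: "\<And>\<eta>. \<eta> \<in> configs V k \<Longrightarrow>
      tv_dist (configs V k) (kernel V E k t \<eta>) (uniform (configs V k)) \<le> 1 / 4"
  shows "1 / (52 * pi\<^sup>2) * real L ^ 2 * ln (real k) \<le> t"
proof -
  have "real (2 * k) \<le> real (L ^ d)" using k by simp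
  then have "2 * k \<le> card V" unfolding card_verts of_nat_le_iff .
  then obtain \<eta> where \<eta>: "\<eta> \<in> configs V k" "real k / 4 \<le> sum \<phi> \<eta>"
    using configs_large_sum[OF finite_verts _ sum_phi _ sum_phi_squared] by (auto simp: \<phi>_def)
  have th2: "0 < \<theta>\<^sup>2" using theta_pos by simp
  have lam: "0 < lam" using lam_bounds(1) th2 by linarith
  define s where "s = exp (- lam * t)"
  have s: "s \<le> 1 / 2" and s2: "3 * (s * (real k / 4))\<^sup>2 \<le> 16 * (k * (2 * \<theta>\<^sup>2)) / lam"
    unfolding s_def using exclusion_mixing[OF phi_eigen phi_gradient lam _ _ \<eta> t mixed] k by auto
  \<comment> \<open>\<theta>^2 <= 8 lam gives 16 * 2 * 8 = 256: the dependence on L cancels.\<close>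
  have "16 * (k * (2 * \<theta>\<^sup>2)) / lam \<le> 256 * k"
    using lam lam_bounds(1) k by (simp add: field_simps)
  with s2 have "3 * (s * (real k / 4))\<^sup>2 \<le> 256 * k" by linarith
  then have "3 * s\<^sup>2 * k * k \<le> 4096 * real k"
    by (simp add: power_mult_distrib power2_eq_square field_simps)
  then have "3 * s\<^sup>2 * k \<le> 4096" using k by simp
  \<comment> \<open>4096 / 3 is rounded up to a power of 2 so that its logarithm, 11 ln 2, can be
    absorbed by ln 2 <= lam t; with the 2 lam t from s^2 this makes 13.\<close>
  then have sk: "s\<^sup>2 * k \<le> 2 ^ 11" by simp
  have s0: "0 < s" by (simp add: s_def)
  have "ln s \<le> ln (1 / 2)" using s s0 by (subst ln_le_cancel_iff) auto
  then have 1: "ln 2 \<le> lam * t" by (simp add: s_def ln_div)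
  have "ln (s\<^sup>2 * k) \<le> ln (2 ^ 11)" using sk s0 k by (subst ln_le_cancel_iff) auto
  also have "ln (s\<^sup>2 * k) = 2 * ln s + ln k"
    using s0 k by (simp add: ln_mult ln_realpow)
  also have "ln (2 ^ 11 :: real) = 11 * ln 2" by (simp only: ln_realpow of_nat_numeral)
  finally have "ln k \<le> 11 * ln 2 + 2 * (lam * t)" by (simp add: s_def)
  also have "\<dots> \<le> 13 * (lam * t)" using 1 by linarith
  also have "\<dots> \<le> 13 * (\<theta>\<^sup>2 * t)"
    using lam_bounds(2) t by (intro mult_left_mono mult_right_mono) auto
  \<comment> \<open>Substituting \<theta> = 2 pi / L turns 13 into 13 * 4 pi^2 = 52 pi^2.\<close>
  finally have "ln k \<le> 13 * (4 * pi\<^sup>2 / (real L)\<^sup>2 * t)" by (simp add: \<theta>_def power_divide power_mult_distrib)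
  then show ?thesis using L by (simp add: field_simps)
qed

end

theorem mainTheorem2:
  "\<exists>c::real. c > 0 \<and>
     (\<forall>(d::nat) (L::nat) (k::nat).
        d \<ge> 1 \<longrightarrow> L \<ge> 2 \<longrightarrow> 1 \<le> k \<longrightarrow> real k \<le> 1 / 2 * real L ^ d \<longrightarrow>
        mixing_time (torus_verts d L) (torus_edges d L) k \<ge> ereal (c * real L ^ 2 * ln (real k)))"
proof (intro exI[of _ "1 / (52 * pi\<^sup>2)"] conjI allI impI)
  show "0 < 1 / (52 * pi\<^sup>2)" by simp
next
  fix d L k :: nat
  assume dL: "1 \<le> d" "2 \<le> L" and k: "1 \<le> k" "real k \<le> 1 / 2 * real L ^ d"
  interpret torus d L using dL by unfold_locales
  show "ereal (1 / (52 * pi\<^sup>2) * real L ^ 2 * ln (real k)) \<le> mixing_time V E k"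
    unfolding mixing_time_def using mixing_lower_bound[OF k] by (intro INF_greatest) auto
qed

end
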